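(* For every function $\psi:\{0,1\}^n\to\mathbb{R}$, $$X(\psi)=\left\{(\boldsymbol{x},z)\in[0,1]^n\times\mathbb{R}:\ \psi_-(\boldsymbol{x})\le z\le\psi_+(\boldsymbol{x})\right\},$$ where $X(\psi)=\operatorname{conv}\{(\boldsymbol{\xi},\psi(\boldsymbol{\xi})):\boldsymbol{\xi}\in\{0,1\}^n\}$ and, for $\boldsymbol{x}\in[0,1]^n$, $$\psi_-(\boldsymbol{x})=\min\left\{\sum_{\boldsymbol{\xi}\in\{0,1\}^n}\mu\bigl(R_{\boldsymbol{\xi}}(X_1,\dots,X_n)\bigr)\psi(\boldsymbol{\xi}):\ X_i\in\mathcal{L},\ \mu(X_i)=x_i\text{ for all }i\in[n]\right\},$$ $$\psi_+(\boldsymbol{x})=\max\left\{\sum_{\boldsymbol{\xi}\in\{0,1\}^n}\mu\bigl(R_{\boldsymbol{\xi}}(X_1,\dots,X_n)\bigr)\psi(\boldsymbol{\xi}):\ X_i\in\mathcal{L},\ \mu(X_i)=x_i\text{ for all }i\in[n]\right\}.$$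
   Context: $[n]=\{1,\dots,n\}$. $\mathcal{L}$ is the collection of finite unions of half-open intervals in $[0,1)$: $\mathcal{L}=\{[a_1,b_1)\cup\dots\cup[a_k,b_k): 0\le a_1<b_1<a_2<b_2<\dots<a_k<b_k\le 1,\ k\in\mathbb{N}\}$, where $k=0$ (the empty set) is allowed, and $\mu(X)=(b_1-a_1)+\dots+(b_k-a_k)$ is the Lebesgue measure restricted to $\mathcal{L}$. A vector $\boldsymbol{\xi}\in\{0,1\}^n$ is identified with the subset $\{i\in[n]:\xi_i=1\}$. For $X_1,\dots,X_n\in\mathcal{L}$ and $\boldsymbol{\xi}\in\{0,1\}^n$, $R_{\boldsymbol{\xi}}(X_1,\dots,X_n)=\{t\in[0,1):\{i\in[n]:t\in X_i\}=\boldsymbol{\xi}\}$; these sets partition $[0,1)$. *)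

theory Defs
  imports "HOL-Analysis.Analysis"
begin

(* The index set [n] is rendered by a finite type 'n, with n = CARD('n). *)

definition intervals :: "real set set" where
  "intervals = {(\<Union>i\<in>{1..k}. {a i..<b i}) | (k::nat) (a :: nat \<Rightarrow> real) (b :: nat \<Rightarrow> real).
     (\<forall>i\<in>{1..k}. a i < b i) \<and>
     (\<forall>i\<in>{1..<k}. b i < a (Suc i)) \<and>
     (1 \<le> k \<longrightarrow> 0 \<le> a 1 \<and> b k \<le> 1)}"

abbreviation mu :: "real set \<Rightarrow> real" where
  "mu \<equiv> measure lborel"

definition vertices :: "(real ^ 'n) set" where
  "vertices = {\<xi>. \<forall>i. \<xi> $ i = 0 \<or> \<xi> $ i = 1}"

definition unit_cube :: "(real ^ 'n) set" where
  "unit_cube = {x. \<forall>i. 0 \<le> x $ i \<and> x $ i \<le> 1}"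

definition region :: "real ^ 'n \<Rightarrow> ('n \<Rightarrow> real set) \<Rightarrow> real set" where
  "region \<xi> X = {t \<in> {0..<1}. {i. t \<in> X i} = {i. \<xi> $ i = 1}}"

definition objective :: "(real ^ 'n \<Rightarrow> real) \<Rightarrow> ('n \<Rightarrow> real set) \<Rightarrow> real" where
  "objective \<psi> X = (\<Sum>\<xi>\<in>vertices. mu (region \<xi> X) * \<psi> \<xi>)"

definition objective_values :: "(real ^ 'n \<Rightarrow> real) \<Rightarrow> real ^ 'n \<Rightarrow> real set" where
  "objective_values \<psi> x =
     {objective \<psi> X | X. \<forall>i. X i \<in> intervals \<and> mu (X i) = x $ i}"

(* LEAST and GREATEST denote the minimum and maximum only when these are attained;
   Min and Max are unsuitable because the set of values is in general infinite. *)

definition psi_minus :: "(real ^ 'n \<Rightarrow> real) \<Rightarrow> real ^ 'n \<Rightarrow> real" where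
  "psi_minus \<psi> x = (LEAST v. v \<in> objective_values \<psi> x)"

definition psi_plus :: "(real ^ 'n \<Rightarrow> real) \<Rightarrow> real ^ 'n \<Rightarrow> real" where
  "psi_plus \<psi> x = (GREATEST v. v \<in> objective_values \<psi> x)"

definition graph_hull :: "(real ^ 'n \<Rightarrow> real) \<Rightarrow> ((real ^ 'n) \<times> real) set" where
  "graph_hull \<psi> = convex hull {(\<xi>, \<psi> \<xi>) | \<xi>. \<xi> \<in> vertices}"

lemma finite_vertices: "finite (vertices :: (real ^ 'n) set)"
proof -
  have "vertices = vec_lambda ` (UNIV \<rightarrow>\<^sub>E {0, 1 :: real} :: ('n \<Rightarrow> real) set)"
    by (force simp: vertices_def PiE_UNIV_domain image_iff vec_eq_iff
        intro: exI[where x = "vec_nth _"])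
  then show ?thesis
    by (metis finite.emptyI finite_PiE finite_class.finite_UNIV finite_imageI finite_insert)
qed

end

theory Submission
  imports Defs
begin

text \<open>
  For measurable $X_1, \dots, X_n$ the measures of the regions are convex weights on the vertices
  with barycentre $(\mu(X_1), \dots, \mu(X_n))$. Conversely, arbitrary convex weights arise by
  cutting $[0,1)$ into consecutive half-open intervals, one per vertex, whose lengths are the
  weights. Hence the set of objective values at a point is exactly the fibre of the hull over that
  point, and such a fibre is compact and convex.
\<close>

section \<open>Building interval unions from left to right\<close>

text \<open>Replacing the right bound 1 of \<open>intervals\<close> by a variable \<open>c\<close>
  gives a notion suited to induction: whatever has been built up to \<open>c\<close> can be extended
  by an interval starting at \<open>c\<close>.\<close>

definition intervals_below :: "real \<Rightarrow> real set set" where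
  "intervals_below c = {(\<Union>i\<in>{1..k}. {a i..<b i}) | (k::nat) (a :: nat \<Rightarrow> real) (b :: nat \<Rightarrow> real).
     (\<forall>i\<in>{1..k}. a i < b i) \<and>
     (\<forall>i\<in>{1..<k}. b i < a (Suc i)) \<and>
     (1 \<le> k \<longrightarrow> 0 \<le> a 1 \<and> b k \<le> c)}"

lemma intervals_below_one: "intervals_below 1 = intervals"
  by (simp add: intervals_below_def intervals_def)

lemma empty_in_intervals_below: "{} \<in> intervals_below c"
  unfolding intervals_below_def
  by (rule CollectI, rule exI[of _ 0]) simp

lemma intervals_below_mono:
  assumes "S \<in> intervals_below c" "c \<le> d"
  shows "S \<in> intervals_below d"
  using assms unfolding intervals_below_def by fastforce

text \<open>The representation demands strict gaps between consecutive intervals, so a new interval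
  that touches the last one has to be merged with it. For \<open>c = d\<close> the appended piece is
  empty.\<close>

lemma intervals_below_append:
  assumes S: "S \<in> intervals_below c" and "0 \<le> c" "c \<le> d"
  shows "S \<union> {c..<d} \<in> intervals_below d"
proof (cases "c = d")
  case True
  then show ?thesis using S by simp
next
  case False
  with \<open>c \<le> d\<close> have cd: "c < d" by simp
  obtain k a b where S_eq: "S = (\<Union>i\<in>{1..k}. {a i..<b i})"
    and ab: "\<forall>i\<in>{1..k}. a i < b i" and gap: "\<forall>i\<in>{1..<k}. b i < a (Suc i)"
    and ends: "1 \<le> k \<longrightarrow> 0 \<le> a 1 \<and> b k \<le> c"
    using S unfolding intervals_below_def by blast
  show ?thesis
  proof (cases "1 \<le> k \<and> b k = c")
    case True
    define b' where "b' = b(k := d)"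
    have "S \<union> {c..<d} = (\<Union>i\<in>{1..k}. {a i..<b' i})"
    proof -
      have k: "{1..k} = insert k {1..<k}" using True by auto
      have "a k < b k" using ab True by auto
      then have "{a k..<b k} \<union> {c..<d} = {a k..<d}"
        using True cd ivl_disj_un_two(3)[of "a k" c d] by simp
      moreover have "(\<Union>i\<in>{1..<k}. {a i..<b' i}) = (\<Union>i\<in>{1..<k}. {a i..<b i})"
        by (simp add: b'_def)
      ultimately show ?thesis
        unfolding S_eq k by (simp add: b'_def) blast
    qed
    moreover have "\<forall>i\<in>{1..k}. a i < b' i" using ab True cd by (force simp: b'_def)
    moreover have "\<forall>i\<in>{1..<k}. b' i < a (Suc i)" using gap by (simp add: b'_def)
    moreover have "1 \<le> k \<longrightarrow> 0 \<le> a 1 \<and> b' k \<le> d" using ends by (simp add: b'_def)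
    ultimately show ?thesis unfolding intervals_below_def by blast
  next
    case False
    \<comment> \<open>Here either \<open>k = 0\<close>, and \<open>0 \<le> c\<close> bounds the left
      end of the first interval, or \<open>b k < c\<close>, which is the strict gap required before
      a new interval.\<close>
    define a' where "a' = a(Suc k := c)"
    define b' where "b' = b(Suc k := d)"
    have "S \<union> {c..<d} = (\<Union>i\<in>{1..Suc k}. {a' i..<b' i})"
    proof -
      have "(\<Union>i\<in>{1..k}. {a' i..<b' i}) = S"
        unfolding S_eq by (rule SUP_cong) (auto simp: a'_def b'_def)
      moreover have "{1..Suc k} = insert (Suc k) {1..k}" by auto
      ultimately show ?thesis by (simp add: a'_def b'_def Un_commute)
    qed
    moreover have "\<forall>i\<in>{1..Suc k}. a' i < b' i" using ab cd by (auto simp: a'_def b'_def)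
    moreover have "\<forall>i\<in>{1..<Suc k}. b' i < a' (Suc i)"
      using gap ends False by (auto simp: a'_def b'_def)
    moreover have "1 \<le> Suc k \<longrightarrow> 0 \<le> a' 1 \<and> b' (Suc k) \<le> d"
      using ends \<open>0 \<le> c\<close> by (auto simp: a'_def b'_def)
    ultimately show ?thesis unfolding intervals_below_def by blast
  qed
qed

text \<open>Scanning the cells from left to right, a selected cell is appended and a skipped one
  only raises the bound. Since \<open>s\<close> is only weakly monotone, cells may be empty, as they
  are for vertices of weight 0.\<close>

lemma Union_consecutive_in_intervals_below:
  fixes s :: "nat \<Rightarrow> real"
  assumes "mono s" "0 \<le> s 0"
  shows "(\<Union>j\<in>{j. j < m \<and> P j}. {s j..<s (Suc j)}) \<in> intervals_below (s m)"
proof (induction m)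
  case 0
  then show ?case using empty_in_intervals_below by simp
next
  case (Suc m)
  have le: "s m \<le> s (Suc m)" and "0 \<le> s m"
    using assms by (auto simp: monoD intro: order_trans[OF _ monoD[of s 0 m]])
  show ?case
  proof (cases "P m")
    case True
    then have "{j. j < Suc m \<and> P j} = insert m {j. j < m \<and> P j}"
      by (auto simp: less_Suc_eq)
    then show ?thesis
      using intervals_below_append[OF Suc \<open>0 \<le> s m\<close> le] by (simp add: Un_commute)
  next
    case False
    then have "{j. j < Suc m \<and> P j} = {j. j < m \<and> P j}"
      by (auto simp: less_Suc_eq)
    then show ?thesis using intervals_below_mono[OF Suc le] by simp
  qed
qed

text \<open>The definition bounds only the first left end and the last right end. The ordering of
  the endpoints carries the lower bound forward from index 1 and the upper bound backward from index
  \<open>k\<close>.\<close>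

lemma intervals_subset:
  assumes "S \<in> intervals"
  shows "S \<subseteq> {0..<1}"
proof -
  obtain k a b where S_eq: "S = (\<Union>i\<in>{1..k}. {a i..<b i})"
    and ab: "\<forall>i\<in>{1..k}. a i < b i" and gap: "\<forall>i\<in>{1..<k}. b i < a (Suc i)"
    and ends: "1 \<le> k \<longrightarrow> 0 \<le> a 1 \<and> b k \<le> (1::real)"
    using assms unfolding intervals_def by blast
  have lower: "1 \<le> i \<Longrightarrow> i \<le> k \<Longrightarrow> 0 \<le> a i" for i
  proof (induction i rule: dec_induct)
    case base
    then show ?case using ends by simp
  next
    case (step i)
    then have "a i < b i" "b i < a (Suc i)" using ab gap by auto
    with step show ?case by simp
  qed
  have upper: "b i \<le> 1" if "i \<le> k" "1 \<le> i" for i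
    using that
  proof (induction i rule: inc_induct)
    case base
    then show ?case using ends by simp
  next
    case (step i)
    then have "b i < a (Suc i)" "a (Suc i) < b (Suc i)" using ab gap by auto
    with step show ?case by simp
  qed
  show ?thesis unfolding S_eq using lower upper by fastforce
qed

lemma intervals_borel: "S \<in> intervals \<Longrightarrow> S \<in> sets borel"
  unfolding intervals_def by auto

lemma initial_interval_in_intervals:
  assumes "0 \<le> x" "x \<le> 1"
  shows "{0..<x} \<in> intervals"
  using intervals_below_mono[OF intervals_below_append[OF empty_in_intervals_below] assms(2)] assms
  by (simp flip: intervals_below_one)

section \<open>Measures of the regions as convex weights\<close>

lemma region_borel:
  assumes "\<And>i. X i \<in> sets borel"
  shows "region \<xi> X \<in> sets borel"
proof -
  have "region \<xi> X = {0..<1} \<inter> (\<Inter>i. if \<xi> $ i = 1 then X i else - X i)"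
    unfolding region_def by (auto split: if_splits)
  also have "\<dots> \<in> sets borel"
    using assms by (intro sets.Int sets.countable_INT'') auto
  finally show ?thesis .
qed

text \<open>A 0/1 vector is determined by its support, which is the identification of vertices with
  subsets of the index set. It makes the regions of distinct vertices disjoint.\<close>

lemma vertices_eqI:
  assumes "\<xi> \<in> vertices" "\<eta> \<in> vertices" "{i. \<xi> $ i = 1} = {i. \<eta> $ i = 1}"
  shows "\<xi> = \<eta>"
  using assms unfolding vertices_def vec_eq_iff by (simp add: set_eq_iff) metis

lemma region_cover:
  assumes "t \<in> {0..<1}"
  shows "\<exists>\<xi>\<in>vertices. t \<in> region \<xi> X"
  using assms
  by (intro bexI[of _ "\<chi> i. if t \<in> X i then 1 else 0"]) (auto simp: vertices_def region_def)

lemma disjoint_family_region: "disjoint_family_on (\<lambda>\<xi>. region \<xi> X) vertices"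
  unfolding disjoint_family_on_def region_def using vertices_eqI by fastforce

lemma measure_eq_sum_regions:
  assumes X: "\<And>i. X i \<in> sets borel" and A: "A \<in> sets borel" "A \<subseteq> {0..<1}"
  shows "mu A = (\<Sum>\<xi>\<in>vertices. mu (A \<inter> region \<xi> X))"
proof -
  \<comment> \<open>Finite additivity of \<open>measure\<close> needs finite
    \<open>emeasure\<close>, because \<open>measure\<close> assigns 0 to sets of infinite
    measure.\<close>
  have fin: "emeasure lborel (A \<inter> region \<xi> X) \<noteq> \<infinity>" for \<xi>
  proof -
    have "emeasure lborel (A \<inter> region \<xi> X) \<le> emeasure lborel {0..<1::real}"
      using A by (intro emeasure_mono) auto
    also have "\<dots> < \<infinity>" by simp
    finally show ?thesis by simp
  qed
  have "A = (\<Union>\<xi>\<in>vertices. A \<inter> region \<xi> X)"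
    using A region_cover[of _ X] by blast
  then have "mu A = mu (\<Union>\<xi>\<in>vertices. A \<inter> region \<xi> X)" by simp
  also have "\<dots> = (\<Sum>\<xi>\<in>vertices. mu (A \<inter> region \<xi> X))"
    using fin disjoint_family_region[of X] A region_borel[of X] X
    by (intro measure_finite_Union finite_vertices) (auto simp: disjoint_family_on_def)
  finally show ?thesis .
qed

lemma sum_measure_regions:
  assumes "\<And>i. X i \<in> sets borel"
  shows "(\<Sum>\<xi>\<in>vertices. mu (region \<xi> X)) = 1"
proof -
  have "{0..<1} \<inter> region \<xi> X = region \<xi> X" for \<xi> by (auto simp: region_def)
  then show ?thesis using measure_eq_sum_regions[of X "{0..<1}"] assms by simp
qed

text \<open>Each region lies entirely inside \<open>X i\<close> or entirely outside it, according to
  whether \<open>\<xi> $ i\<close> is 1 or 0. The coordinate therefore acts as the indicator of the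
  regions that make up \<open>X i\<close>.\<close>

lemma measure_eq_barycentre:
  assumes X: "\<And>i. X i \<in> intervals"
  shows "mu (X i) = (\<Sum>\<xi>\<in>vertices. mu (region \<xi> X) * \<xi> $ i)"
proof -
  have "mu (X i) = (\<Sum>\<xi>\<in>vertices. mu (X i \<inter> region \<xi> X))"
    using X intervals_subset intervals_borel by (intro measure_eq_sum_regions) blast+
  also have "\<dots> = (\<Sum>\<xi>\<in>vertices. mu (region \<xi> X) * \<xi> $ i)"
  proof (rule sum.cong)
    fix \<xi> :: "real ^ 'a"
    assume "\<xi> \<in> vertices"
    then consider "\<xi> $ i = 0" | "\<xi> $ i = 1" by (auto simp: vertices_def)
    then show "mu (X i \<inter> region \<xi> X) = mu (region \<xi> X) * \<xi> $ i"
    proof cases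
      case 1
      then have "X i \<inter> region \<xi> X = {}" by (fastforce simp: region_def set_eq_iff)
      with 1 show ?thesis by simp
    next
      case 2
      then have "X i \<inter> region \<xi> X = region \<xi> X" by (auto simp: region_def)
      with 2 show ?thesis by simp
    qed
  qed simp
  finally show ?thesis .
qed

section \<open>Convex weights and their realisation by intervals\<close>

text \<open>The hull of a finite set is described by weights on its points. The map onto the graph
  is injective, so these weights can be indexed by the vertices themselves.\<close>

lemma mem_graph_hull_iff:
  "(x, z) \<in> graph_hull \<psi> \<longleftrightarrow>
    (\<exists>u. (\<forall>\<xi>\<in>vertices. 0 \<le> u \<xi>) \<and> sum u vertices = 1 \<and>
      (\<forall>i. (\<Sum>\<xi>\<in>vertices. u \<xi> * \<xi> $ i) = x $ i) \<and> (\<Sum>\<xi>\<in>vertices. u \<xi> * \<psi> \<xi>) = z)"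
  (is "_ \<longleftrightarrow> (\<exists>u. ?P u)")
proof -
  let ?g = "\<lambda>\<xi>. (\<xi>, \<psi> \<xi>)"
  have img: "{(\<xi>, \<psi> \<xi>) | \<xi>. \<xi> \<in> vertices} = ?g ` vertices" by auto
  have inj: "inj_on ?g vertices" by (auto simp: inj_on_def)
  have comb: "(\<Sum>\<xi>\<in>vertices. u \<xi> *\<^sub>R ?g \<xi>) = (x, z) \<longleftrightarrow>
      (\<forall>i. (\<Sum>\<xi>\<in>vertices. u \<xi> * \<xi> $ i) = x $ i) \<and> (\<Sum>\<xi>\<in>vertices. u \<xi> * \<psi> \<xi>) = z" for u
    by (simp add: prod_eq_iff fst_sum snd_sum vec_eq_iff)
  have "(x, z) \<in> graph_hull \<psi> \<longleftrightarrow>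
    (\<exists>w. (\<forall>p\<in>?g ` vertices. 0 \<le> w p) \<and> sum w (?g ` vertices) = 1 \<and>
      (\<Sum>p\<in>?g ` vertices. w p *\<^sub>R p) = (x, z))"
    unfolding graph_hull_def img convex_hull_finite[OF finite_imageI[OF finite_vertices]]
    by (simp only: mem_Collect_eq)
  also have "\<dots> \<longleftrightarrow> (\<exists>w. ?P (\<lambda>\<xi>. w (?g \<xi>)))"
    by (simp only: sum.reindex[OF inj] o_def ball_simps comb)
  also have "\<dots> \<longleftrightarrow> (\<exists>u. ?P u)"
  proof
    assume "\<exists>u. ?P u"
    then obtain u where "?P u" ..
    \<comment> \<open>A weight on vertices becomes a weight on graph points by reading off the first
      component.\<close>
    then have "?P (\<lambda>\<xi>. (u \<circ> fst) (?g \<xi>))" by simp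
    then show "\<exists>w. ?P (\<lambda>\<xi>. w (?g \<xi>))" by (rule exI[of _ "u \<circ> fst"])
  next
    assume "\<exists>w. ?P (\<lambda>\<xi>. w (?g \<xi>))"
    then obtain w where "?P (\<lambda>\<xi>. w (?g \<xi>))" ..
    then show "\<exists>u. ?P u" by (rule exI[of _ "\<lambda>\<xi>. w (?g \<xi>)"])
  qed
  finally show ?thesis .
qed

text \<open>Enumerate the vertices, give vertex \<open>e j\<close> a cell \<open>J j\<close> of
  length \<open>u (e j)\<close>, and let \<open>X i\<close> collect the cells whose vertex has
  \<open>i\<close>-th coordinate 1. The region of \<open>e j\<close> is then exactly its
  cell.\<close>

lemma exists_intervals_with_region_measures:
  fixes u :: "real ^ 'n \<Rightarrow> real"
  assumes nonneg: "\<And>\<xi>. \<xi> \<in> vertices \<Longrightarrow> 0 \<le> u \<xi>" and sum1: "sum u vertices = 1"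
  shows "\<exists>X. (\<forall>i. X i \<in> intervals) \<and> (\<forall>\<xi>\<in>vertices. mu (region \<xi> X) = u \<xi>)"
proof -
  define N where "N = card (vertices :: (real ^ 'n) set)"
  obtain e where e: "bij_betw e {..<N} (vertices :: (real ^ 'n) set)"
    using ex_bij_betw_nat_finite[OF finite_vertices] unfolding N_def atLeast0LessThan by blast
  \<comment> \<open>The cut points are partial sums of the weights. Truncating at \<open>N\<close>
    keeps \<open>s\<close> constant beyond the last vertex, so it is monotone on all of
    \<open>nat\<close>.\<close>
  define s where "s m = (\<Sum>j<min m N. u (e j))" for m
  have e_mem: "j < N \<Longrightarrow> e j \<in> vertices" for j
    using e by (auto simp: bij_betw_def)
  have s_0: "s 0 = 0" by (simp add: s_def)
  have s_N: "s N = 1"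
    using sum.reindex_bij_betw[OF e, of u] sum1 by (simp add: s_def)
  have s_Suc: "s (Suc j) = s j + u (e j)" if "j < N" for j
    using that by (simp add: s_def min_def)
  have "mono s"
    unfolding s_def by (intro monoI sum_mono2) (auto intro: nonneg e_mem)
  define J where "J j = {s j..<s (Suc j)}" for j
  have J_cover: "\<exists>j<N. t \<in> J j" if t: "t \<in> {0..<1}" for t
  proof -
    \<comment> \<open>The cell containing \<open>t\<close> ends at the first cut point beyond
      \<open>t\<close>. This index is not 0 because \<open>s 0 = 0\<close>, so its predecessor
      numbers the cell.\<close>
    define m where "m = (LEAST m. t < s m)"
    have ex: "t < s N" using t s_N by simp
    have "t < s m" unfolding m_def using ex by (rule LeastI)
    moreover from this have "m \<noteq> 0" using t s_0 by (intro notI) simp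
    then obtain j where j: "m = Suc j" by (cases m) auto
    moreover have "\<not> t < s j" using not_less_Least[of j "\<lambda>m. t < s m"] j m_def by simp
    moreover have "m \<le> N" unfolding m_def using ex by (rule Least_le)
    ultimately show ?thesis by (intro exI[of _ j]) (simp add: J_def)
  qed
  have J_unique: "i = j" if "t \<in> J i" "t \<in> J j" for i j t
  proof (rule ccontr)
    assume "i \<noteq> j"
    then consider "Suc i \<le> j" | "Suc j \<le> i" by linarith
    then show False
      using that monoD[OF \<open>mono s\<close>, of "Suc i" j] monoD[OF \<open>mono s\<close>, of "Suc j" i]
      unfolding J_def by cases auto
  qed
  have J_sub: "J j \<subseteq> {0..<1}" if "j < N" for j
    using that monoD[OF \<open>mono s\<close>, of 0 j] monoD[OF \<open>mono s\<close>, of "Suc j" N] s_0 s_N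
    unfolding J_def by auto
  define X where "X i = (\<Union>j\<in>{j. j < N \<and> e j $ i = 1}. J j)" for i
  have "X i \<in> intervals" for i
    using Union_consecutive_in_intervals_below[OF \<open>mono s\<close>, of N "\<lambda>j. e j $ i = 1"]
    by (simp add: s_0 s_N X_def J_def intervals_below_one)
  moreover have "mu (region \<xi> X) = u \<xi>" if \<xi>: "\<xi> \<in> vertices" for \<xi>
  proof -
    obtain j where j: "j < N" "\<xi> = e j"
      using e \<xi> by (auto simp: bij_betw_def)
    \<comment> \<open>Since \<open>t\<close> lies in no cell other than \<open>J l\<close>, only the
      coordinates of \<open>e l\<close> decide which sets \<open>X i\<close> contain it.\<close>
    have X_mem: "{i. t \<in> X i} = {i. e l $ i = 1}" if "t \<in> J l" "l < N" for t l
      using that J_unique unfolding X_def by blast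
    have "region \<xi> X = J j"
    proof
      show "J j \<subseteq> region \<xi> X"
        using J_sub[OF j(1)] X_mem[OF _ j(1)] j(2) unfolding region_def by blast
      show "region \<xi> X \<subseteq> J j"
      proof
        fix t assume t: "t \<in> region \<xi> X"
        then obtain l where l: "l < N" "t \<in> J l" using J_cover unfolding region_def by blast
        then have "{i. e l $ i = 1} = {i. e j $ i = 1}"
          using X_mem[of t l] t j(2) unfolding region_def by simp
        then have "e l = e j" using vertices_eqI e_mem l(1) j(1) by blast
        then have "l = j" using e l(1) j(1) by (auto simp: bij_betw_def inj_on_def)
        with l show "t \<in> J j" by simp
      qed
    qed
    then show ?thesis
      using s_Suc[OF j(1)] nonneg[OF \<xi>] j(2) by (simp add: J_def)
  qed
  ultimately show ?thesis by blast
qed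

text \<open>Both the measures of the \<open>X i\<close> and the objective are linear in the measures
  of the regions, with the coefficients that appear in the hull. Region measures thus serve as
  weights, and given weights are realised as region measures.\<close>

lemma mem_objective_values_iff: "z \<in> objective_values \<psi> x \<longleftrightarrow> (x, z) \<in> graph_hull \<psi>"
proof
  assume "z \<in> objective_values \<psi> x"
  then obtain X where X: "\<And>i. X i \<in> intervals" "\<And>i. mu (X i) = x $ i"
    and z: "z = objective \<psi> X"
    unfolding objective_values_def by blast
  show "(x, z) \<in> graph_hull \<psi>"
    unfolding mem_graph_hull_iff
    using sum_measure_regions[of X] X intervals_borel measure_eq_barycentre[of X]
    by (intro exI[of _ "\<lambda>\<xi>. mu (region \<xi> X)"]) (auto simp: z objective_def)
next
  assume "(x, z) \<in> graph_hull \<psi>"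
  then obtain u where u: "\<And>\<xi>. \<xi> \<in> vertices \<Longrightarrow> 0 \<le> u \<xi>" "sum u vertices = 1"
    and x: "\<And>i. (\<Sum>\<xi>\<in>vertices. u \<xi> * \<xi> $ i) = x $ i"
    and z: "(\<Sum>\<xi>\<in>vertices. u \<xi> * \<psi> \<xi>) = z"
    unfolding mem_graph_hull_iff by blast
  obtain X where X: "\<And>i. X i \<in> intervals" "\<And>\<xi>. \<xi> \<in> vertices \<Longrightarrow> mu (region \<xi> X) = u \<xi>"
    using exists_intervals_with_region_measures[of u] u by blast
  have "mu (X i) = x $ i" for i
    using measure_eq_barycentre[of X i] X x by simp
  moreover have "objective \<psi> X = z" using X z by (simp add: objective_def)
  ultimately show "z \<in> objective_values \<psi> x"
    using X unfolding objective_values_def by blast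
qed

section \<open>Fibres of the hull: nonempty, compact and convex\<close>

lemma objective_values_eq_vimage: "objective_values \<psi> x = Pair x -` graph_hull \<psi>"
  using mem_objective_values_iff by blast

lemma objective_values_nonempty:
  assumes "x \<in> unit_cube"
  shows "objective_values \<psi> x \<noteq> {}"
proof -
  have "\<forall>i. {0..<x $ i} \<in> intervals \<and> mu {0..<x $ i} = x $ i"
    using assms initial_interval_in_intervals by (simp add: unit_cube_def)
  then have "objective \<psi> (\<lambda>i. {0..<x $ i}) \<in> objective_values \<psi> x"
    unfolding objective_values_def by (intro CollectI exI[of _ "\<lambda>i. {0..<x $ i}"]) simp
  then show ?thesis by blast
qed

text \<open>A point of the hull comes from sets in \<open>intervals\<close>, and its coordinates are
  their measures. These sets lie in [0,1).\<close>

lemma graph_hull_fst_in_unit_cube: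
  assumes "(x, z) \<in> graph_hull \<psi>"
  shows "x \<in> unit_cube"
proof -
  obtain X where X: "\<And>i. X i \<in> intervals" and x: "\<And>i. mu (X i) = x $ i"
    using assms unfolding mem_objective_values_iff[symmetric] objective_values_def by blast
  have "0 \<le> x $ i \<and> x $ i \<le> 1" for i
  proof -
    have "mu (X i) \<le> mu {0..<1}"
      using intervals_subset[OF X] intervals_borel[OF X]
      by (intro measure_mono_fmeasurable) (simp_all add: fmeasurable_def)
    then show ?thesis unfolding x[symmetric] by simp
  qed
  then show ?thesis by (simp add: unit_cube_def)
qed

text \<open>The hull of finitely many points is compact. Slicing it by the closed set
  \<open>{x} \<times> UNIV\<close> and projecting continuously to the second component preserves
  compactness.\<close>

lemma compact_objective_values: "compact (objective_values \<psi> x)"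
proof -
  have "{(\<xi>, \<psi> \<xi>) | \<xi>. \<xi> \<in> vertices} = (\<lambda>\<xi>. (\<xi>, \<psi> \<xi>)) ` vertices" by auto
  then have "compact (graph_hull \<psi>)"
    unfolding graph_hull_def by (simp add: finite_imp_compact_convex_hull finite_vertices)
  then have "compact (graph_hull \<psi> \<inter> ({x} \<times> UNIV))"
    by (intro compact_Int_closed closed_Times) auto
  then have "compact (snd ` (graph_hull \<psi> \<inter> ({x} \<times> UNIV)))"
    by (intro compact_continuous_image continuous_intros)
  also have "snd ` (graph_hull \<psi> \<inter> ({x} \<times> UNIV)) = objective_values \<psi> x"
    unfolding objective_values_eq_vimage by force
  finally show ?thesis .
qed

lemma convex_objective_values: "convex (objective_values \<psi> x)"
proof (rule convexI)
  fix v w a b :: real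
  assume vw: "v \<in> objective_values \<psi> x" "w \<in> objective_values \<psi> x"
    and ab: "0 \<le> a" "0 \<le> b" "a + b = 1"
  have "convex (graph_hull \<psi>)" by (simp add: graph_hull_def)
  with vw ab have "a *\<^sub>R (x, v) + b *\<^sub>R (x, w) \<in> graph_hull \<psi>"
    unfolding mem_objective_values_iff by (simp only: convexD)
  \<comment> \<open>Convex combinations of two points over \<open>x\<close> stay over
    \<open>x\<close>.\<close>
  moreover have "a *\<^sub>R x + b *\<^sub>R x = x" using ab by (simp flip: scaleR_add_left)
  ultimately show "a *\<^sub>R v + b *\<^sub>R w \<in> objective_values \<psi> x"
    unfolding mem_objective_values_iff by simp
qed

section \<open>Attained extrema and the description of the hull\<close>

text \<open>A nonempty compact set of reals attains its infimum, so \<open>LEAST\<close> denotes a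
  genuine minimum here.\<close>

lemma psi_minus_least:
  assumes "x \<in> unit_cube"
  shows "psi_minus \<psi> x \<in> objective_values \<psi> x"
    and "v \<in> objective_values \<psi> x \<Longrightarrow> psi_minus \<psi> x \<le> v"
proof -
  obtain m where m: "m \<in> objective_values \<psi> x" "\<And>v. v \<in> objective_values \<psi> x \<Longrightarrow> m \<le> v"
    using compact_attains_inf[OF compact_objective_values objective_values_nonempty[OF assms]]
    by blast
  then have "psi_minus \<psi> x = m"
    unfolding psi_minus_def by (intro Least_equality)
  with m show "psi_minus \<psi> x \<in> objective_values \<psi> x"
    and "v \<in> objective_values \<psi> x \<Longrightarrow> psi_minus \<psi> x \<le> v"
    by auto
qed

lemma psi_plus_greatest:
  assumes "x \<in> unit_cube"
  shows "psi_plus \<psi> x \<in> objective_values \<psi> x"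
    and "v \<in> objective_values \<psi> x \<Longrightarrow> v \<le> psi_plus \<psi> x"
proof -
  obtain m where m: "m \<in> objective_values \<psi> x" "\<And>v. v \<in> objective_values \<psi> x \<Longrightarrow> v \<le> m"
    using compact_attains_sup[OF compact_objective_values objective_values_nonempty[OF assms]]
    by blast
  then have "psi_plus \<psi> x = m"
    unfolding psi_plus_def by (intro Greatest_equality)
  with m show "psi_plus \<psi> x \<in> objective_values \<psi> x"
    and "v \<in> objective_values \<psi> x \<Longrightarrow> v \<le> psi_plus \<psi> x"
    by auto
qed

text \<open>The fibre over \<open>x\<close> is a convex set of reals, hence an interval, and it
  contains both of its extreme values. It therefore consists of everything between them.\<close>

lemma mem_graph_hull_iff_between:
  assumes "x \<in> unit_cube"
  shows "(x, z) \<in> graph_hull \<psi> \<longleftrightarrow> psi_minus \<psi> x \<le> z \<and> z \<le> psi_plus \<psi> x"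
proof
  assume "(x, z) \<in> graph_hull \<psi>"
  then show "psi_minus \<psi> x \<le> z \<and> z \<le> psi_plus \<psi> x"
    using psi_minus_least(2)[OF assms] psi_plus_greatest(2)[OF assms]
    unfolding mem_objective_values_iff by blast
next
  assume "psi_minus \<psi> x \<le> z \<and> z \<le> psi_plus \<psi> x"
  moreover have "is_interval (objective_values \<psi> x)"
    by (simp add: is_interval_convex_1 convex_objective_values)
  ultimately have "z \<in> objective_values \<psi> x"
    using psi_minus_least(1)[OF assms] psi_plus_greatest(1)[OF assms]
    by (blast intro: mem_is_interval_1_I)
  then show "(x, z) \<in> graph_hull \<psi>" by (simp only: mem_objective_values_iff)
qed

text \<open>Attainment is asserted alongside the set equality because \<open>LEAST\<close> and
  \<open>GREATEST\<close> carry no information when no extremum exists.\<close>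

theorem theorem5:
  fixes \<psi> :: "real ^ 'n \<Rightarrow> real"
  shows "(\<forall>x\<in>unit_cube.
            psi_minus \<psi> x \<in> objective_values \<psi> x \<and>
            psi_plus \<psi> x \<in> objective_values \<psi> x \<and>
            (\<forall>v\<in>objective_values \<psi> x. psi_minus \<psi> x \<le> v \<and> v \<le> psi_plus \<psi> x)) \<and>
         graph_hull \<psi> =
           {(x, z). x \<in> unit_cube \<and> psi_minus \<psi> x \<le> z \<and> z \<le> psi_plus \<psi> x}"
proof (intro conjI ballI)
  show "graph_hull \<psi> = {(x, z). x \<in> unit_cube \<and> psi_minus \<psi> x \<le> z \<and> z \<le> psi_plus \<psi> x}"
    using graph_hull_fst_in_unit_cube mem_graph_hull_iff_between by fast
qed (simp_all add: psi_minus_least psi_plus_greatest)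

end
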